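(* Let $r\ge 1$ and let $m_1,\dots,m_r$ be integers with $m_i\ge 2$ for every $1\le i\le r$. Then for every integer $k\ge 1$, $$ch_k(K_{m_1,\ldots,m_r})\le 948\, r\Big(k+\log\frac{m_1+\cdots+m_r}{r}\Big),$$ where $\log$ denotes the natural logarithm.
   Context: $K_{m_1,\ldots,m_r}$ denotes the complete $r$-partite graph whose $i$-th vertex class has $m_i$ vertices. A graph $G=(V,E)$ is $(a:b)$-choosable if for every family of sets $\{S(v):v\in V\}$ with $|S(v)|=a$ for all $v$, there exist subsets $C(v)\subseteq S(v)$ with $|C(v)|=b$ for every $v$ and $C(u)\cap C(v)=\emptyset$ whenever $u,v$ are adjacent. $ch_k(G)$ is the smallest integer $n$ such that $G$ is $(n:k)$-choosable. *)

theory Defs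
  imports Complex_Main "Graph_Theory.Pair_Digraph"
begin

text \<open>Undirected simple graphs are represented, as in the library, by symmetric loop-free digraphs
  (the locale \<^locale>\<open>pair_graph\<close>).\<close>

definition complete_multipartite :: "nat \<Rightarrow> (nat \<Rightarrow> nat) \<Rightarrow> (nat \<times> nat) pair_pre_digraph" where
  "complete_multipartite r m =
     (let V = (SIGMA i:{1..r}. {..<m i})
      in \<lparr> pverts = V, parcs = {(u, v). u \<in> V \<and> v \<in> V \<and> fst u \<noteq> fst v} \<rparr>)"

text \<open>Colours are natural numbers. For finite graphs this is no restriction on the
  sets \<open>S v\<close>, see \<open>choosable_any_colours\<close> below. Finiteness of \<open>S v\<close> is only relevant
  for \<open>a = 0\<close>, because \<^const>\<open>card\<close> is 0 on infinite sets.\<close>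

definition choosable :: "'a pair_pre_digraph \<Rightarrow> nat \<Rightarrow> nat \<Rightarrow> bool" where
  "choosable G a b \<longleftrightarrow>
     (\<forall>S :: 'a \<Rightarrow> nat set.
        (\<forall>v \<in> pverts G. finite (S v) \<and> card (S v) = a) \<longrightarrow>
        (\<exists>C. (\<forall>v \<in> pverts G. C v \<subseteq> S v \<and> card (C v) = b) \<and>
             (\<forall>u \<in> pverts G. \<forall>v \<in> pverts G. (u, v) \<in> parcs G \<longrightarrow> C u \<inter> C v = {})))"

text \<open>The minimum exists for every finite loop-free graph, see \<open>ex_choosable\<close> below.\<close>

definition ch :: "nat \<Rightarrow> 'a pair_pre_digraph \<Rightarrow> nat" where
  "ch k G = (LEAST n. choosable G n k)"

lemma pair_graph_complete_multipartite: "pair_graph (complete_multipartite r m)"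
proof -
  let ?V = "SIGMA i:{1..r}. {..<m i}"
  have "finite {(u, v). u \<in> ?V \<and> v \<in> ?V \<and> fst u \<noteq> fst v}"
    by (rule finite_subset[of _ "?V \<times> ?V"]) auto
  moreover have "sym {(u, v). u \<in> ?V \<and> v \<in> ?V \<and> fst u \<noteq> fst v}"
    by (rule symI) simp
  moreover have "u \<noteq> v" if "fst u \<noteq> fst v" for u v :: "nat \<times> nat"
    using that by metis
  ultimately show ?thesis
    by unfold_locales
      (simp_all add: complete_multipartite_def Let_def symmetric_def arcs_ends_conv
        case_prod_beta)
qed

lemma choosable_any_colours:
  fixes S :: "'a \<Rightarrow> 'c set"
  assumes fin: "finite (pverts G)" and ch: "choosable G a b"
    and S: "\<And>v. v \<in> pverts G \<Longrightarrow> finite (S v) \<and> card (S v) = a"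
  shows "\<exists>C. (\<forall>v \<in> pverts G. C v \<subseteq> S v \<and> card (C v) = b) \<and>
             (\<forall>u \<in> pverts G. \<forall>v \<in> pverts G. (u, v) \<in> parcs G \<longrightarrow> C u \<inter> C v = {})"
proof -
  let ?U = "\<Union>v \<in> pverts G. S v"
  have "finite ?U" using fin S by auto
  from finite_imp_inj_to_nat_seg[OF this] obtain f :: "'c \<Rightarrow> nat" where f: "inj_on f ?U"
    by (elim exE conjE)
  have fS: "inj_on f (S v)" if "v \<in> pverts G" for v
    using that by (intro inj_on_subset[OF f]) auto
  have "\<forall>v \<in> pverts G. finite (f ` S v) \<and> card (f ` S v) = a"
    using S fS by (simp add: card_image)
  with ch[unfolded choosable_def, THEN spec, of "\<lambda>v. f ` S v"]
  obtain C where "\<forall>v \<in> pverts G. C v \<subseteq> f ` S v \<and> card (C v) = b"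
    and "\<forall>u \<in> pverts G. \<forall>v \<in> pverts G. (u, v) \<in> parcs G \<longrightarrow> C u \<inter> C v = {}"
    by (elim impE exE conjE)
  note C = this(1)[rule_format] and D = this(2)[rule_format]
  let ?D = "\<lambda>v. {x \<in> S v. f x \<in> C v}"
  have "card (?D v) = b" if v: "v \<in> pverts G" for v
  proof -
    have "f ` ?D v = C v" using C[OF v] by auto
    moreover have "inj_on f (?D v)" by (rule inj_on_subset[OF fS[OF v]]) auto
    ultimately show ?thesis using C[OF v] card_image by metis
  qed
  moreover have "?D u \<inter> ?D v = {}"
    if "u \<in> pverts G" "v \<in> pverts G" "(u, v) \<in> parcs G" for u v
    using D[OF that] by blast
  ultimately show ?thesis by (intro exI[of _ ?D]) blast
qed

lemma ex_choosable:
  assumes fin: "finite (pverts G)" and loopfree: "\<And>v. (v, v) \<notin> parcs G"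
  shows "choosable G (k * card (pverts G)) k"
  unfolding choosable_def
proof (intro allI impI)
  fix S :: "'a \<Rightarrow> nat set"
  assume S: "\<forall>v \<in> pverts G. finite (S v) \<and> card (S v) = k * card (pverts G)"
  have "\<exists>C. (\<forall>v \<in> W. C v \<subseteq> S v \<and> card (C v) = k) \<and>
            (\<forall>u \<in> W. \<forall>v \<in> W. u \<noteq> v \<longrightarrow> C u \<inter> C v = {})"
    if "W \<subseteq> pverts G" for W
    using finite_subset[OF that fin] that
  proof (induction W rule: finite_induct)
    case empty
    then show ?case by simp
  next
    case (insert w W)
    then have "W \<subseteq> pverts G" by simp
    from insert.IH[OF this] obtain C
      where "\<forall>v \<in> W. C v \<subseteq> S v \<and> card (C v) = k"
        and "\<forall>u \<in> W. \<forall>v \<in> W. u \<noteq> v \<longrightarrow> C u \<inter> C v = {}"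
      by (elim exE conjE)
    note C = this(1)[rule_format] and D = this(2)[rule_format]
    let ?B = "\<Union>v \<in> W. C v"
    have "card ?B \<le> (\<Sum>v\<in>W. card (C v))"
      using insert.hyps(1) by (rule card_UN_le)
    also have "\<dots> = k * card W" using C by simp
    finally have B: "card ?B \<le> k * card W" .
    have "finite ?B"
    proof (rule finite_UN_I[OF insert.hyps(1)])
      fix v assume "v \<in> W"
      then have "C v \<subseteq> S v" "finite (S v)" using C S insert.prems by auto
      then show "finite (C v)" by (rule finite_subset)
    qed
    then have "card (S w) - card ?B \<le> card (S w - ?B)"
      by (rule diff_card_le_card_Diff)
    moreover have "Suc (card W) \<le> card (pverts G)"
      using card_mono[OF fin insert.prems] insert.hyps by simp
    then have "k * card W + k \<le> k * card (pverts G)"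
      by (metis add.commute mult_Suc_right mult_le_mono2)
    moreover have "card (S w) = k * card (pverts G)" using S insert.prems by simp
    ultimately have "k \<le> card (S w - ?B)" using B by linarith
    then obtain T where T: "T \<subseteq> S w - ?B" "card T = k"
      by (meson obtain_subset_with_card_n)
    have TC: "T \<inter> C v = {}" "C v \<inter> T = {}" if "v \<in> W" for v
      using T(1) that by blast+
    show ?case
    proof (intro exI[of _ "C(w := T)"] conjI ballI impI)
      fix v assume "v \<in> insert w W"
      then show "(C(w := T)) v \<subseteq> S v" using C T(1) by (cases "v = w") auto
    next
      fix v assume "v \<in> insert w W"
      then show "card ((C(w := T)) v) = k" using C T(2) by (cases "v = w") auto
    next
      fix u v assume "u \<in> insert w W" "v \<in> insert w W" "u \<noteq> v"
      then show "(C(w := T)) u \<inter> (C(w := T)) v = {}"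
        using D[of u v] TC[of u] TC[of v] by (cases "u = w"; cases "v = w") simp_all
    qed
  qed
  from this[OF subset_refl] obtain C
    where C: "\<forall>v \<in> pverts G. C v \<subseteq> S v \<and> card (C v) = k"
      and D: "\<forall>u \<in> pverts G. \<forall>v \<in> pverts G. u \<noteq> v \<longrightarrow> C u \<inter> C v = {}"
    by (elim exE conjE)
  have "C u \<inter> C v = {}" if "u \<in> pverts G" "v \<in> pverts G" "(u, v) \<in> parcs G" for u v
  proof -
    have "u \<noteq> v" using loopfree that(3) by blast
    then show ?thesis using D that by simp
  qed
  with C show "\<exists>C. (\<forall>v \<in> pverts G. C v \<subseteq> S v \<and> card (C v) = k) \<and>
    (\<forall>u \<in> pverts G. \<forall>v \<in> pverts G. (u, v) \<in> parcs G \<longrightarrow> C u \<inter> C v = {})"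
    by blast
qed

end

theory Submission
  imports Defs
begin

text \<open>Assign every colour independently to a uniformly random element of \<open>{1..2 * r}\<close>: value
  \<open>i \<le> r\<close> dedicates the colour to the \<open>i\<close>-th class, and a value above \<open>r\<close> puts it into a common
  reserve. With \<open>r * m\<close> vertices in all and lists of size about \<open>948 * r * (k + ln m)\<close>, a vertex
  misses \<open>k\<close> colours dedicated to its class with probability far below \<open>1 / m\<close>, so with positive
  probability at most \<open>r\<close> vertices do. Its number of reserve colours is below \<open>r * k\<close> only with
  probability exponentially small in \<open>r * (k + ln m)\<close>, so no vertex is short of reserve. The at most
  \<open>r\<close> unsatisfied vertices then greedily take pairwise disjoint sets of reserve colours. This avoids
  the factor \<open>ln r\<close> that a union bound over all vertices would cost.\<close>

text \<open>A lower-tail Chernoff bound in counting form: for a uniformly random \<open>f\<close>,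
  Markov's inequality is applied to 2 to the power of minus the number of hits, and independence of
  the values factorises the expectation.\<close>

lemma card_PiE_few_hits:
  fixes U :: "'a set" and J :: "'b set"
  assumes "finite U" "S \<subseteq> U" "finite J" "A \<subseteq> J" "J \<noteq> {}"
  shows "real (card {f \<in> U \<rightarrow>\<^sub>E J. card {x \<in> S. f x \<in> A} < t})
           \<le> exp (real t - real (card S) * real (card A) / (2 * real (card J)))
              * real (card (U \<rightarrow>\<^sub>E J))"
proof -
  let ?F = "U \<rightarrow>\<^sub>E J" and ?c = "\<lambda>f. card {x \<in> S. f x \<in> A}"
  let ?g = "\<lambda>x j. if x \<in> S \<and> j \<in> A then 1/2 else (1::real)"
  define q where "q = real (card J)"
  \<comment> \<open>Half the probability of a hit: the weight \<open>?g x\<close> has mean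
    \<open>1 - y\<close> over \<open>J\<close> when \<open>x \<in> S\<close>, and mean 1
    otherwise.\<close>
  define y where "y = real (card A) / (2 * q)"
  have q: "q > 0" using assms by (simp add: q_def card_gt_0_iff)
  have finF: "finite ?F" using assms by (simp add: finite_PiE)
  have finS: "finite S" using assms finite_subset by blast
  have "card A \<le> card J" using assms by (simp add: card_mono)
  then have y: "0 \<le> 1 - y" using q by (simp add: y_def q_def field_simps)
  have pow: "(\<Prod>x\<in>U. ?g x (f x)) = (1/2) ^ ?c f" for f
  proof -
    have "(\<Prod>x\<in>U. ?g x (f x)) = (\<Prod>x\<in>{x \<in> S. f x \<in> A}. 1/2)"
      using assms by (intro prod.mono_neutral_cong_right) auto
    then show ?thesis by simp
  qed
  have row: "(\<Sum>j\<in>J. ?g x j) = q * (if x \<in> S then 1 - y else 1)" for x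
  proof (cases "x \<in> S")
    case True
    have "(\<Sum>j\<in>J. ?g x j) = (\<Sum>j\<in>J. 1 - (if j \<in> A then 1/2 else 0))"
      using True by (intro sum.cong) auto
    also have "\<dots> = q - real (card (J \<inter> A)) / 2"
      using assms by (simp add: sum_subtractf q_def sum.If_cases)
    also have "J \<inter> A = A" using assms by blast
    finally have "(\<Sum>j\<in>J. ?g x j) = q - real (card A) / 2" .
    moreover have "q * y = real (card A) / 2" using q by (simp add: y_def)
    ultimately show ?thesis using True by (simp add: right_diff_distrib)
  qed (simp add: q_def)
  have "real (card {f \<in> ?F. ?c f < t}) = (\<Sum>f | f \<in> ?F \<and> ?c f < t. 1)" by simp
  also have "\<dots> \<le> (\<Sum>f | f \<in> ?F \<and> ?c f < t. 2 ^ t * (1/2) ^ ?c f)"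
  proof (rule sum_mono)
    fix f assume "f \<in> {f \<in> ?F. ?c f < t}"
    then have "(1/2::real) ^ t \<le> (1/2) ^ ?c f" by (intro power_decreasing) auto
    then show "(1::real) \<le> 2 ^ t * (1/2) ^ ?c f" by (simp add: field_simps)
  qed
  also have "\<dots> \<le> (\<Sum>f\<in>?F. 2 ^ t * (1/2) ^ ?c f)"
    using finF by (intro sum_mono2) auto
  also have "\<dots> = 2 ^ t * (\<Sum>f\<in>?F. \<Prod>x\<in>U. ?g x (f x))"
    by (simp only: pow sum_distrib_left)
  \<comment> \<open>Independence: a sum over all functions of a product of pointwise weights is the
    product of the pointwise sums.\<close>
  also have "(\<Sum>f\<in>?F. \<Prod>x\<in>U. ?g x (f x)) = (\<Prod>x\<in>U. \<Sum>j\<in>J. ?g x j)"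
    using assms by (intro prod_sum_PiE[symmetric]) auto
  also have "\<dots> = (\<Prod>x\<in>U. q) * (\<Prod>x\<in>U. if x \<in> S then 1 - y else 1)"
    by (simp only: row prod.distrib)
  also have "(\<Prod>x\<in>U. q) = real (card ?F)"
    using assms by (simp add: card_PiE q_def)
  also have "(\<Prod>x\<in>U. if x \<in> S then 1 - y else 1) = (1 - y) ^ card S"
  proof -
    have "(\<Prod>x\<in>U. if x \<in> S then 1 - y else 1) = (\<Prod>x\<in>S. 1 - y)"
      using assms by (intro prod.mono_neutral_cong_right) auto
    then show ?thesis by simp
  qed
  \<comment> \<open>Uses 2 \<le> e and 1 - y \<le> exp (-y).\<close>
  also have "2 ^ t * (real (card ?F) * (1 - y) ^ card S)
      \<le> exp 1 ^ t * (real (card ?F) * exp (- y) ^ card S)"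
    using y exp_ge_add_one_self[of 1] exp_ge_add_one_self[of "- y"]
    by (intro mult_mono power_mono) auto
  also have "\<dots> = exp (real t - real (card S) * y) * real (card ?F)"
    by (simp add: exp_of_nat_mult[symmetric] exp_diff exp_minus field_simps)
  finally show ?thesis by (simp add: y_def q_def)
qed

text \<open>This is \<open>ex_choosable\<close> for the complete graph on \<open>W\<close>, once
  every set has been trimmed to exactly \<open>k * card W\<close> elements.\<close>

lemma disjoint_subsets_of_large_sets:
  fixes S :: "'a \<Rightarrow> nat set"
  assumes "finite W" and S: "\<And>v. v \<in> W \<Longrightarrow> finite (S v) \<and> k * card W \<le> card (S v)"
  shows "\<exists>C. (\<forall>v\<in>W. C v \<subseteq> S v \<and> card (C v) = k) \<and>
             (\<forall>u\<in>W. \<forall>v\<in>W. u \<noteq> v \<longrightarrow> C u \<inter> C v = {})"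
proof -
  let ?K = "\<lparr>pverts = W, parcs = {(u, v). u \<noteq> v}\<rparr>"
  have "choosable ?K (k * card W) k"
    using ex_choosable[of ?K k] \<open>finite W\<close> by simp
  moreover have "\<forall>v\<in>W. \<exists>T. T \<subseteq> S v \<and> finite T \<and> card T = k * card W"
    using S by (meson obtain_subset_with_card_n)
  then obtain T where T: "\<And>v. v \<in> W \<Longrightarrow> T v \<subseteq> S v \<and> finite (T v) \<and> card (T v) = k * card W"
    by metis
  ultimately obtain C where C: "\<forall>v\<in>W. C v \<subseteq> T v \<and> card (C v) = k"
      "\<forall>u\<in>W. \<forall>v\<in>W. u \<noteq> v \<longrightarrow> C u \<inter> C v = {}"
    unfolding choosable_def by (auto dest!: spec[of _ T])
  have "\<forall>v\<in>W. C v \<subseteq> S v \<and> card (C v) = k"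
    using C(1) T by blast
  with C(2) show ?thesis by blast
qed

text \<open>With average class size \<open>exp L\<close>, the number of vertices enters the
  exponents of the tail bounds as \<open>L\<close>. The constant 12 gives n / (4r) \<ge> 3(k + L),
  which brings the expected number of bad vertices down to r/e and that of short vertices down to
  1/e.\<close>

lemma choosable_complete_multipartite:
  fixes r k n :: nat and m :: "nat \<Rightarrow> nat"
  assumes r: "r \<ge> 1" and k: "k \<ge> 1"
    and M: "(\<Sum>i = 1..r. m i) = real r * exp L" and L: "L \<ge> 0"
    and n: "real n \<ge> 12 * real r * (real k + L)"
  shows "choosable (complete_multipartite r m) n k"
  unfolding choosable_def
proof (intro allI impI)
  let ?G = "complete_multipartite r m"
  define V where "V = (SIGMA i:{1..r}. {..<m i})"
  have G: "pverts ?G = V" "parcs ?G = {(u, v). u \<in> V \<and> v \<in> V \<and> fst u \<noteq> fst v}"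
    by (simp_all add: complete_multipartite_def V_def Let_def)
  have finV: "finite V" by (simp add: V_def)
  have cardV: "real (card V) = real r * exp L" using M by (simp add: V_def)
  fix S :: "nat \<times> nat \<Rightarrow> nat set"
  assume "\<forall>v\<in>pverts ?G. finite (S v) \<and> card (S v) = n"
  then have S: "finite (S v)" "card (S v) = n" if "v \<in> V" for v using G that by auto
  define U where "U = (\<Union>v\<in>V. S v)"
  have U: "finite U" "\<And>v. v \<in> V \<Longrightarrow> S v \<subseteq> U" using finV S by (auto simp: U_def)
  define J where "J = {1..2 * r}"
  have J: "finite J" "J \<noteq> {}" "card J = 2 * r" using r by (auto simp: J_def)
  let ?F = "U \<rightarrow>\<^sub>E J"
  define N where "N = real (card ?F)"
  have finF: "finite ?F" using U J by (simp add: finite_PiE)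
  have N: "N > 0" using U J r by (simp add: N_def card_PiE)
  define own where "own f v = card {x \<in> S v. f x \<in> {fst v}}" for f v
  define res where "res f v = card {x \<in> S v. f x \<in> {r+1..2*r}}" for f v
  \<comment> \<open>A dedicated value has probability 1/(2r), and the reserve has probability 1/2;
    the tail bound halves both, whence n/(4r) here and n/4 for \<open>res\<close>.\<close>
  have own: "real (card {f \<in> ?F. own f v < k}) \<le> exp (real k - real n / (4 * real r)) * N"
    if v: "v \<in> V" for v
    using card_PiE_few_hits[OF U(1) U(2)[OF v] J(1), of "{fst v}" k] J v S[OF v]
    by (auto simp: own_def N_def V_def J_def)
  have res: "real (card {f \<in> ?F. res f v < r * k}) \<le> exp (real (r * k) - real n / 4) * N"
    if v: "v \<in> V" for v
    using card_PiE_few_hits[OF U(1) U(2)[OF v] J(1), of "{r+1..2*r}" "r * k"] J S[OF v] r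
    by (auto simp: res_def N_def J_def field_simps)
  define bad where "bad f = {v \<in> V. own f v < k}" for f
  define short where "short f = {v \<in> V. res f v < r * k}" for f
  \<comment> \<open>Double counting, in the role of linearity of expectation.\<close>
  have swap: "(\<Sum>f\<in>?F. real (card {v \<in> V. P f v})) = (\<Sum>v\<in>V. real (card {f \<in> ?F. P f v}))"
    for P :: "(nat \<Rightarrow> nat) \<Rightarrow> nat \<times> nat \<Rightarrow> bool"
  proof -
    have "(\<Sum>f\<in>?F. card {v \<in> V. P f v}) = (\<Sum>v\<in>V. card {f \<in> ?F. P f v})"
      using sum_multicount_gen[OF finF finV, of P "\<lambda>v. card {f \<in> ?F. P f v}"] by simp
    then show ?thesis by (simp flip: of_nat_sum)
  qed
  have k1: "real k \<ge> 1" and r1: "real r \<ge> 1" using k r by auto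
  have small: "exp (- 1) < (1/2 :: real)"
    using exp_lower_Taylor_quadratic[of "1::real"] by (simp add: exp_minus field_simps)
  have "(\<Sum>f\<in>?F. real (card (bad f))) \<le> real (card V) * (exp (real k - real n / (4 * real r)) * N)"
    unfolding bad_def swap using own by (intro sum_bounded_above) simp
  also have "\<dots> = real r * (exp (L + real k - real n / (4 * real r)) * N)"
    by (simp add: cardV exp_add exp_diff)
  also have "\<dots> \<le> real r * (exp (- 1) * N)"
  proof -
    have "3 * (real k + L) \<le> real n / (4 * real r)"
      using n r1 by (simp add: field_simps)
    then show ?thesis using k1 L N by (intro mult_left_mono mult_right_mono) auto
  qed
  also have "\<dots> < real r * (1/2 * N)" using small N r1 by simp
  finally have sum_bad: "(\<Sum>f\<in>?F. real (card (bad f)) / real r) < N / 2"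
    using r1 by (simp add: field_simps flip: sum_divide_distrib)
  have "(\<Sum>f\<in>?F. real (card (short f))) \<le> real (card V) * (exp (real (r * k) - real n / 4) * N)"
    unfolding short_def swap using res by (intro sum_bounded_above) simp
  \<comment> \<open>The bound r \<le> exp (r - 1) moves the factor r into the exponent, where the
    term of order rk from n/4 absorbs it.\<close>
  also have "\<dots> \<le> exp (real r - 1) * exp L * (exp (real (r * k) - real n / 4) * N)"
    using exp_ge_add_one_self[of "real r - 1"] N
    unfolding cardV by (intro mult_right_mono) auto
  also have "\<dots> = exp (real r - 1 + L + real r * real k - real n / 4) * N"
    by (simp add: exp_add exp_diff)
  also have "\<dots> \<le> exp (- 1) * N"
  proof -
    have "real r \<le> real r * real k" "L \<le> real r * L"
      using k1 r1 L mult_right_mono[of 1 "real r" L] by auto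
    moreover have "3 * (real r * real k) + 3 * (real r * L) \<le> real n / 4"
      using n by (simp add: algebra_simps)
    ultimately have "real r - 1 + L + real r * real k - real n / 4 \<le> - 1"
      using r1 L by linarith
    then show ?thesis using N by simp
  qed
  also have "\<dots> < N / 2" using small N by simp
  finally have sum_short: "(\<Sum>f\<in>?F. real (card (short f))) < N / 2" .
  \<comment> \<open>Both averages are below 1/2, so some \<open>f\<close> has total below 1.
    Dividing \<open>bad\<close> by r but not \<open>short\<close> makes this one inequality give
    fewer than r bad vertices and, by integrality, no short vertex.\<close>
  have "\<exists>f\<in>?F. real (card (bad f)) / real r + real (card (short f)) < 1"
  proof (rule ccontr)
    assume "\<not> ?thesis"
    then have "(\<Sum>f\<in>?F. 1) \<le> (\<Sum>f\<in>?F. real (card (bad f)) / real r + real (card (short f)))"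
      by (intro sum_mono) force
    then show False using sum_bad sum_short by (simp add: sum.distrib N_def)
  qed
  then obtain f where f: "real (card (bad f)) / real r + real (card (short f)) < 1" by blast
  have "card (short f) = 0"
  proof (rule ccontr)
    assume "card (short f) \<noteq> 0"
    then have "real (card (short f)) \<ge> 1" by simp
    moreover have "real (card (bad f)) / real r \<ge> 0" by simp
    ultimately show False using f by linarith
  qed
  then have no_short: "res f v \<ge> r * k" if "v \<in> V" for v
    using that finV by (cases v) (auto simp: short_def not_less)
  have "real (card (bad f)) / real r < 1" using f by linarith
  then have few_bad: "card (bad f) \<le> r" using r1 by (simp add: field_simps)
  have finB: "finite (bad f)" using finV by (simp add: bad_def)
  let ?R = "\<lambda>v. {x \<in> S v. f x \<in> {r+1..2*r}}"
  have R: "finite (?R v) \<and> k * card (bad f) \<le> card (?R v)" if "v \<in> bad f" for v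
  proof
    have v: "v \<in> V" using that by (simp add: bad_def)
    show "finite (?R v)" using S[OF v] by simp
    have "k * card (bad f) \<le> r * k" using few_bad by simp
    then show "k * card (bad f) \<le> card (?R v)"
      using no_short[OF v] unfolding res_def by (rule order_trans)
  qed
  have "\<exists>D. (\<forall>v\<in>bad f. D v \<subseteq> ?R v \<and> card (D v) = k) \<and>
      (\<forall>u\<in>bad f. \<forall>v\<in>bad f. u \<noteq> v \<longrightarrow> D u \<inter> D v = {})"
    using finB R by (rule disjoint_subsets_of_large_sets)
  then obtain D where "\<forall>v\<in>bad f. D v \<subseteq> ?R v \<and> card (D v) = k"
    and "\<forall>u\<in>bad f. \<forall>v\<in>bad f. u \<noteq> v \<longrightarrow> D u \<inter> D v = {}"
    by (elim exE conjE)
  note D = this(1)[rule_format] and Ddisj = this(2)[rule_format]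
  have "\<forall>v\<in>V - bad f. \<exists>T. T \<subseteq> {x \<in> S v. f x \<in> {fst v}} \<and> card T = k"
  proof
    fix v assume "v \<in> V - bad f"
    then have "k \<le> card {x \<in> S v. f x \<in> {fst v}}" by (auto simp: bad_def own_def not_less)
    then show "\<exists>T. T \<subseteq> {x \<in> S v. f x \<in> {fst v}} \<and> card T = k"
      by (meson obtain_subset_with_card_n)
  qed
  then obtain T where T: "\<And>v. v \<in> V - bad f \<Longrightarrow> T v \<subseteq> {x \<in> S v. f x \<in> {fst v}} \<and> card (T v) = k"
    by metis
  have class_le: "fst v \<le> r" if "v \<in> V" for v using that by (auto simp: V_def)
  let ?C = "\<lambda>v. if v \<in> bad f then D v else T v"
  have C: "?C v \<subseteq> S v \<and> card (?C v) = k" if "v \<in> V" for v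
    using D[of v] T[of v] that by auto
  have D_gt: "f x > r" if "v \<in> bad f" "x \<in> D v" for v x
    using D[OF that(1)] that(2) by auto
  have T_eq: "f x = fst v" if "v \<in> V - bad f" "x \<in> T v" for v x
    using T[OF that(1)] that(2) by auto
  \<comment> \<open>Two bad vertices have disjoint sets by the choice of \<open>D\<close>; a bad and
    a good one are separated by values above r against values at most r; two good ones by their
    different class indices.\<close>
  have disj: "?C u \<inter> ?C v = {}" if uv: "u \<in> V" "v \<in> V" "fst u \<noteq> fst v" for u v
  proof (rule ccontr)
    assume "?C u \<inter> ?C v \<noteq> {}"
    then obtain x where x: "x \<in> ?C u" "x \<in> ?C v" by blast
    have "u \<noteq> v" using uv by blast
    then show False
      using x uv Ddisj[of u v] D_gt[of u x] D_gt[of v x] T_eq[of u x] T_eq[of v x]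
        class_le[of u] class_le[of v]
      by (cases "u \<in> bad f"; cases "v \<in> bad f") (simp_all, blast)
  qed
  show "\<exists>C. (\<forall>v\<in>pverts ?G. C v \<subseteq> S v \<and> card (C v) = k) \<and>
      (\<forall>u\<in>pverts ?G. \<forall>v\<in>pverts ?G. (u, v) \<in> parcs ?G \<longrightarrow> C u \<inter> C v = {})"
    using C disj by (intro exI[of _ ?C]) (simp add: G)
qed

theorem theorem2:
  fixes r k :: nat and m :: "nat \<Rightarrow> nat"
  assumes "r \<ge> 1"
    and "\<And>i. 1 \<le> i \<Longrightarrow> i \<le> r \<Longrightarrow> m i \<ge> 2"
    and "k \<ge> 1"
  shows "real (ch k (complete_multipartite r m))
           \<le> 948 * real r * (real k + ln (real (\<Sum>i = 1..r. m i) / real r))"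
proof -
  define L where "L = ln (real (\<Sum>i = 1..r. m i) / real r)"
  define n where "n = nat \<lfloor>948 * real r * (real k + L)\<rfloor>"
  have r: "real r \<ge> 1" and k: "real k \<ge> 1" using assms by auto
  have "(\<Sum>i = 1..r. 1) \<le> (\<Sum>i = 1..r. m i)"
    using assms(2) by (intro sum_mono) force
  then have M: "real r \<le> real (\<Sum>i = 1..r. m i)" by (subst of_nat_le_iff) simp
  then have avg: "1 \<le> real (\<Sum>i = 1..r. m i) / real r" using r by (simp add: field_simps)
  then have L: "L \<ge> 0" by (simp add: L_def)
  have "real (\<Sum>i = 1..r. m i) = real r * exp L"
    unfolding L_def using avg r by (subst exp_ln) auto
  \<comment> \<open>As this product is at least 1, the gap between 948 and 12 covers the loss of
    less than 1 from rounding down in \<open>n\<close>.\<close>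
  moreover have "1 * 1 \<le> real r * (real k + L)"
    using r k L by (intro mult_mono) auto
  then have "12 * real r * (real k + L) \<le> real n" and n: "real n \<le> 948 * real r * (real k + L)"
    unfolding n_def by linarith+
  ultimately have "choosable (complete_multipartite r m) n k"
    using choosable_complete_multipartite[OF assms(1,3)] L by simp
  then have "ch k (complete_multipartite r m) \<le> n"
    unfolding ch_def by (rule Least_le)
  then show ?thesis using n by (simp add: L_def)
qed

end
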